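(* Let $\mathbb{F}_q$ be a finite field of characteristic $p$, with prime field $\mathbb{F}_p$. Pick any $g\in\mathbb{F}_q[x]$, any additive polynomial $A\in\mathbb{F}_p[x]$, and any $h\in\mathbb{F}_p[x]$. Let $B:=x^{q/p}+x^{q/p^2}+\dots+x^p+x$. Then the polynomial $f(x):=g(B(x))+h(B(x))A(x)$ permutes $\mathbb{F}_q$ if and only if all of the following hold: $A$ permutes $\ker B$; $B(g(x))+h(x)A(x)$ permutes $\mathbb{F}_p$; and $h$ has no roots in $\mathbb{F}_p$.
   Context: An additive polynomial over a field of characteristic $p$ is a polynomial of the form $\sum_{i=0}^k a_i x^{p^i}$. $\ker B$ denotes the kernel of the map $\mathbb{F}_q\to\mathbb{F}_q$ induced by $B$. A polynomial permutes a set $S\subseteq\mathbb{F}_q$ if it induces a bijection $S\to S$.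
   Formalization: The formal theorem assumes q > p; for q = p the statement is false, since then B = x, ker B = {0}, and g = x − x², A = h = x give f = x, which permutes F_p although h(0) = 0. *)

theory Defs
  imports
    "HOL-Library.Cardinality"
    "HOL-Computational_Algebra.Polynomial"
    "HOL-Computational_Algebra.Primes"
    "HOL-Number_Theory.Cong"
begin

text \<open>The prime field is the image of the canonical map from the integers.\<close>

definition prime_field :: "'a::field set" where
  "prime_field = range of_int"

definition poly_over :: "'a::field set \<Rightarrow> 'a poly set" where
  "poly_over K = {f. \<forall>i. coeff f i \<in> K}"

definition additive_poly :: "'a::field poly \<Rightarrow> bool" where
  "additive_poly A \<longleftrightarrow> (\<exists>k a. A = (\<Sum>i\<le>k. monom (a i) (CHAR('a) ^ i)))"

definition permutes_on :: "'a::field poly \<Rightarrow> 'a set \<Rightarrow> bool" where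
  "permutes_on f S \<longleftrightarrow> bij_betw (poly f) S S"

definition ker_poly :: "'a::field poly \<Rightarrow> 'a set" where
  "ker_poly f = {x. poly f x = 0}"

text \<open>
  The sum of the monomials with exponents \<open>q/p, q/p\<^sup>2, \<dots>, p, 1\<close>: as \<open>q\<close> is a power of
  \<open>p\<close>, the summation index runs over \<open>1, \<dots>, n\<close> where \<open>q = p\<^sup>n\<close>.
\<close>

definition trace_poly :: "'a::finite_field poly" where
  "trace_poly = (\<Sum>i | 1 \<le> i \<and> CHAR('a) ^ i dvd CARD('a). monom 1 (CARD('a) div CHAR('a) ^ i))"

lemma trace_poly_altdef:
  assumes "CARD('a::finite_field) = CHAR('a) ^ n"
  shows "(trace_poly :: 'a poly) = (\<Sum>i<n. monom 1 (CHAR('a) ^ i))"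
proof -
  have p: "1 < CHAR('a)"
    using CHAR_prime[where 'a='a] by (rule prime_gt_1_nat)
  have "{i. 1 \<le> i \<and> CHAR('a) ^ i dvd CARD('a)} = {1..n}"
    using p by (auto simp: assms dest: power_dvd_imp_le intro: le_imp_power_dvd)
  then have "(trace_poly :: 'a poly) = (\<Sum>i\<in>{1..n}. monom 1 (CHAR('a) ^ n div CHAR('a) ^ i))"
    by (simp add: trace_poly_def assms)
  also have "\<dots> = (\<Sum>i<n. monom 1 (CHAR('a) ^ i))"
    by (rule sum.reindex_bij_witness[of _ "\<lambda>i. n - i" "\<lambda>i. n - i"])
      (use p in \<open>auto simp: power_diff\<close>)
  finally show ?thesis .
qed

lemma prime_field_altdef:
  "(prime_field :: 'a::finite_field set) = of_nat ` {..<CHAR('a)}"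
proof
  show "(prime_field :: 'a set) \<subseteq> of_nat ` {..<CHAR('a)}"
  proof
    fix x :: 'a
    assume "x \<in> prime_field"
    then obtain m where m: "x = of_int m"
      by (auto simp: prime_field_def)
    define k where "k = nat (m mod int CHAR('a))"
    have k: "int k = m mod int CHAR('a)"
      by (simp add: k_def)
    have "(of_int (int k) :: 'a) = of_int m"
      by (simp only: of_int_eq_iff_cong_CHAR k) (simp add: cong_def)
    moreover have "k < CHAR('a)"
      using k by (metis CHAR_pos of_nat_0_less_iff of_nat_less_iff pos_mod_bound)
    ultimately show "x \<in> of_nat ` {..<CHAR('a)}"
      using m by (intro image_eqI[of _ _ k]) auto
  qed
  show "of_nat ` {..<CHAR('a)} \<subseteq> (prime_field :: 'a set)"
    unfolding prime_field_def by (metis image_subsetI of_int_of_nat_eq rangeI)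
qed

text \<open>
  For \<open>q = p\<close> the kernel of \<open>B = x\<close> is trivial, and \<open>f\<close> may permute the field although
  \<open>h\<close> has a root: \<open>g = x - x\<^sup>2\<close> and \<open>A = h = x\<close> give \<open>f = x\<close>.
\<close>

lemma prime_order_counterexample:
  fixes g A h :: "'a::finite_field poly"
  assumes "CARD('a) = CHAR('a)"
  defines "g \<equiv> [:0, 1, -1:]" and "A \<equiv> [:0, 1:]" and "h \<equiv> [:0, 1:]"
  shows "A \<in> poly_over prime_field" and "additive_poly A" and "h \<in> poly_over prime_field"
    and "permutes_on (pcompose g trace_poly + pcompose h trace_poly * A) UNIV"
    and "\<exists>x\<in>prime_field. poly h x = 0"
proof -
  have 01: "(0 :: 'a) \<in> prime_field" "(1 :: 'a) \<in> prime_field"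
    unfolding prime_field_def by (metis of_int_0 rangeI, metis of_int_1 rangeI)
  then show "A \<in> poly_over prime_field" "h \<in> poly_over prime_field"
    by (auto simp: poly_over_def A_def h_def coeff_pCons split: nat.split)
  have "A = (\<Sum>i\<le>0. monom 1 (CHAR('a) ^ i))"
    by (simp add: A_def monom_altdef)
  then show "additive_poly A"
    unfolding additive_poly_def by (intro exI[of _ 0] exI[of _ "\<lambda>_. 1"])
  have B: "(trace_poly :: 'a poly) = [:0, 1:]"
    using assms(1) by (subst trace_poly_altdef[of 1]) (simp_all add: monom_altdef)
  have "pcompose g trace_poly + pcompose h trace_poly * A = [:0, 1:]"
    by (simp add: B g_def h_def A_def)
  then show "permutes_on (pcompose g trace_poly + pcompose h trace_poly * A) UNIV"
    by (auto simp: permutes_on_def bij_betw_def inj_on_def)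
  show "\<exists>x\<in>prime_field. poly h x = 0"
    using 01 by (auto simp: h_def intro!: bexI[of _ 0])
qed

end

theory Submission
  imports Defs "HOL-Algebra.Exponent"
begin

text \<open>
  The map \<open>B\<close> is the trace onto the prime field \<open>F\<^sub>p\<close>. It is \<open>F\<^sub>p\<close>-linear and commutes with \<open>A\<close>,
  so \<open>B (f x) = \<phi> (B x)\<close> with \<open>\<phi> = B \<circ> g + h * A\<close>. Hence \<open>f\<close> permutes the fibres of \<open>B\<close> in the way
  \<open>\<phi>\<close> permutes \<open>F\<^sub>p\<close>, and on the fibre over \<open>c\<close> it is the affine map \<open>x \<mapsto> g c + h c * A x\<close>. The fibres are
  cosets of \<open>ker B\<close>, which is nontrivial because \<open>p < q\<close>; so \<open>f\<close> is injective on all of them iff \<open>h\<close>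
  has no root in \<open>F\<^sub>p\<close> and \<open>A\<close> is injective on \<open>ker B\<close>.
\<close>

text \<open>Since x^q = x on the whole field, p divides every inner binomial coefficient q choose k.
  If P is the exact power of p in q, then p does not divide q choose P, which forces P = q.\<close>

lemma CARD_finite_field_eq_CHAR_power:
  obtains n where "0 < n" "CARD('a::finite_field) = CHAR('a) ^ n"
proof -
  let ?p = "CHAR('a)" and ?q = "CARD('a)"
  have p: "prime ?p"
    by (rule CHAR_prime)
  have q: "?q > 0"
    by simp
  \<comment> \<open>The polynomial \<open>(X + 1)\<^sup>q - X\<^sup>q - 1\<close> vanishes everywhere but has degree less than \<open>q\<close>.\<close>
  define D :: "'a poly" where "D = (\<Sum>k\<in>{1..<?q}. monom (of_nat (?q choose k)) k)"
  have "poly D x = poly 0 x" for x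
  proof -
    have "x + 1 = (x + 1) ^ ?q"
      by (simp only: finite_field_power_card_eq_same)
    also have "\<dots> = (\<Sum>k\<le>?q. of_nat (?q choose k) * x ^ k)"
      by (simp add: binomial_ring)
    also have "{..?q} = insert 0 (insert ?q {1..<?q})"
      by auto
    also have "(\<Sum>k\<in>\<dots>. of_nat (?q choose k) * x ^ k) = 1 + (x ^ ?q + poly D x)"
      by (simp add: D_def poly_sum poly_monom)
    finally show ?thesis
      by (simp add: finite_field_power_card_eq_same)
  qed
  moreover have "degree D < ?q"
    unfolding D_def
    by (rule degree_lessI) (auto simp: coeff_sum intro!: sum.neutral)
  ultimately have "D = 0"
    by (intro poly_eqI_degree[of UNIV]) auto
  have dvd: "?p dvd (?q choose k)" if "0 < k" "k < ?q" for k
  proof -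
    have "coeff D k = of_nat (?q choose k)"
      using that by (simp add: D_def coeff_sum)
    with \<open>D = 0\<close> show ?thesis
      by (simp add: of_nat_eq_0_iff_char_dvd)
  qed
  obtain m where m: "?q = ?p ^ multiplicity ?p ?q * m" "\<not> ?p dvd m"
    using multiplicity_decompose'[of ?q ?p] p q by auto
  define P where "P = ?p ^ multiplicity ?p ?q"
  have "m > 0"
    using m(2) by (cases m) auto
  \<comment> \<open>\<open>const_p_fac\<close>: p divides P * m choose P exactly as often as it
    divides m, which is not at all.\<close>
  then have "multiplicity ?p (?q choose P) = 0"
    using const_p_fac[of m ?p "multiplicity ?p ?q"] p m
    unfolding P_def by (simp add: not_dvd_imp_multiplicity_0)
  moreover have "P > 0" "P \<le> ?q"
    using p m(1) \<open>m > 0\<close> by (auto simp: P_def prime_gt_0_nat intro: dvd_imp_le multiplicity_dvd)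
  moreover have "?q choose P \<noteq> 0"
    using \<open>P \<le> ?q\<close> by simp
  ultimately have "\<not> ?p dvd (?q choose P)"
    using p by (simp add: multiplicity_eq_zero_iff)
  with dvd[of P] \<open>P > 0\<close> \<open>P \<le> ?q\<close> have "?q = P"
    by linarith
  moreover have "?q \<noteq> 1"
    by (auto simp: card_1_singleton_iff) (metis UNIV_I singletonD zero_neq_one)
  ultimately show ?thesis
    using that[of "multiplicity ?p ?q"] by (cases "multiplicity ?p ?q") (auto simp: P_def)
qed

section \<open>Frobenius and the prime field\<close>

lemma frobenius_add:
  fixes x y :: "'a::finite_field"
  shows "(x + y) ^ (CHAR('a) ^ n) = x ^ (CHAR('a) ^ n) + y ^ (CHAR('a) ^ n)"
  by (rule freshmans_dream'[OF CHAR_prime refl])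

lemma frobenius_sum:
  fixes f :: "'b \<Rightarrow> 'a::finite_field"
  shows "sum f S ^ (CHAR('a) ^ n) = (\<Sum>i\<in>S. f i ^ (CHAR('a) ^ n))"
  by (rule freshmans_dream_sum'[OF CHAR_prime refl])

text \<open>By Fermat's little theorem the prime field consists of roots of X^p - X. It has p
  elements, and there are at most p roots.\<close>

lemma prime_field_iff_frobenius_fixed:
  fixes x :: "'a::finite_field"
  shows "x \<in> prime_field \<longleftrightarrow> x ^ CHAR('a) = x"
proof -
  let ?p = "CHAR('a)"
  have p: "1 < ?p"
    using CHAR_prime[where 'a='a] by (rule prime_gt_1_nat)
  define R where "R = {x::'a. poly (monom 1 ?p - monom 1 1) x = 0}"
  have "of_nat k ^ ?p = (of_nat k :: 'a)" for k
  proof (induction k)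
    case (Suc k)
    then show ?case
      using frobenius_add[of "1::'a" "of_nat k" 1] by simp
  qed (use p in auto)
  then have sub: "(prime_field :: 'a set) \<subseteq> R"
    unfolding prime_field_altdef R_def by (auto simp: poly_monom)
  have "inj_on (of_nat :: nat \<Rightarrow> 'a) {..<?p}"
    by (auto simp: inj_on_def of_nat_eq_iff_cong_CHAR cong_def)
  then have card: "card (prime_field :: 'a set) = ?p"
    by (simp add: prime_field_altdef card_image)
  have "coeff (monom 1 ?p - monom 1 1 :: 'a poly) ?p \<noteq> 0"
    using p by simp
  then have "monom 1 ?p - monom 1 1 \<noteq> (0 :: 'a poly)"
    by (metis coeff_0)
  then have "card R \<le> degree (monom 1 ?p - monom 1 1 :: 'a poly)"
    unfolding R_def by (rule card_poly_roots_bound)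
  also have "\<dots> \<le> ?p"
    using p by (intro degree_diff_le) (auto intro: order.trans[OF degree_monom_le])
  finally have "prime_field = R"
    using sub card by (intro card_seteq) auto
  then show ?thesis
    by (auto simp: R_def poly_monom)
qed

lemma prime_field_frobenius_power:
  fixes x :: "'a::finite_field"
  assumes "x \<in> prime_field"
  shows "x ^ (CHAR('a) ^ n) = x"
  using assms by (induction n) (simp_all add: prime_field_iff_frobenius_fixed power_mult)

lemma prime_field_divide:
  fixes x y :: "'a::finite_field"
  assumes "x \<in> prime_field" "y \<in> prime_field"
  shows "x / y \<in> prime_field"
  using assms by (simp add: prime_field_iff_frobenius_fixed power_divide)

text \<open>Frobenius fixes the coefficients of \<open>h\<close>, so it acts on the argument
  alone.\<close>

lemma poly_over_prime_field_frobenius: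
  fixes h :: "'a::finite_field poly"
  assumes "h \<in> poly_over prime_field"
  shows "poly h (x ^ (CHAR('a) ^ n)) = poly h x ^ (CHAR('a) ^ n)"
proof -
  have "coeff h i ^ (CHAR('a) ^ n) = coeff h i" for i
    using assms by (intro prime_field_frobenius_power) (auto simp: poly_over_def)
  then show ?thesis
    by (simp add: poly_altdef frobenius_sum power_mult_distrib mult.commute flip: power_mult)
qed

lemma poly_over_prime_field_closed:
  fixes h :: "'a::finite_field poly"
  assumes "h \<in> poly_over prime_field" "x \<in> prime_field"
  shows "poly h x \<in> prime_field"
  using poly_over_prime_field_frobenius[OF assms(1), of x 1] assms(2)
  by (simp add: prime_field_iff_frobenius_fixed)

section \<open>Additive polynomials\<close>

lemma additive_poly_add:
  fixes A :: "'a::finite_field poly"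
  assumes "additive_poly A"
  shows "poly A (x + y) = poly A x + poly A y"
  using assms unfolding additive_poly_def
  by (auto simp: poly_sum poly_monom frobenius_add algebra_simps sum.distrib)

lemma additive_poly_0:
  fixes A :: "'a::finite_field poly"
  assumes "additive_poly A"
  shows "poly A 0 = 0"
  using additive_poly_add[OF assms, of 0 0] by (metis add_cancel_right_right add_0)

lemma additive_poly_sum:
  fixes A :: "'a::finite_field poly"
  assumes "additive_poly A"
  shows "poly A (sum f S) = (\<Sum>i\<in>S. poly A (f i))"
  by (induction S rule: infinite_finite_induct)
    (simp_all add: additive_poly_0[OF assms] additive_poly_add[OF assms])

lemma additive_poly_diff:
  fixes A :: "'a::finite_field poly"
  assumes "additive_poly A"
  shows "poly A (x - y) = poly A x - poly A y"
  using additive_poly_add[OF assms, of "x - y" y] by simp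

lemma additive_poly_scale:
  fixes A :: "'a::finite_field poly"
  assumes "additive_poly A" "c \<in> prime_field"
  shows "poly A (c * x) = c * poly A x"
  using assms(1) unfolding additive_poly_def
  by (auto simp: poly_sum poly_monom power_mult_distrib prime_field_frobenius_power[OF assms(2)]
      sum_distrib_left mult_ac)

section \<open>The trace polynomial\<close>

lemma additive_trace_poly: "additive_poly (trace_poly :: 'a::finite_field poly)"
proof -
  obtain n where "0 < n" and n: "CARD('a) = CHAR('a) ^ n"
    by (rule CARD_finite_field_eq_CHAR_power)
  from \<open>0 < n\<close> have "{..<n} = {..n - 1}"
    by auto
  then show ?thesis
    unfolding additive_poly_def trace_poly_altdef[OF n] by auto
qed

text \<open>The trace is a sum of Frobenius powers; \<open>A\<close> commutes with each of them and,
  being additive, with their sum.\<close>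

lemma trace_poly_commute:
  fixes A :: "'a::finite_field poly"
  assumes "A \<in> poly_over prime_field" "additive_poly A"
  shows "poly trace_poly (poly A x) = poly A (poly trace_poly x)"
proof -
  obtain n where "0 < n" and n: "CARD('a) = CHAR('a) ^ n"
    by (rule CARD_finite_field_eq_CHAR_power)
  show ?thesis
    by (simp add: trace_poly_altdef[OF n] poly_sum poly_monom additive_poly_sum[OF assms(2)]
        poly_over_prime_field_frobenius[OF assms(1)])
qed

lemma trace_poly_in_prime_field: "poly trace_poly (x :: 'a::finite_field) \<in> prime_field"
proof -
  obtain n where "0 < n" and n: "CARD('a) = CHAR('a) ^ n"
    by (rule CARD_finite_field_eq_CHAR_power)
  have x: "x ^ (CHAR('a) ^ n) = x"
    using finite_field_power_card_eq_same[of x] n by simp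
  let ?s = "\<Sum>i<n. x ^ (CHAR('a) ^ i)"
  have "?s ^ CHAR('a) = (\<Sum>i<n. x ^ (CHAR('a) ^ Suc i))"
    using frobenius_sum[of "\<lambda>i. x ^ (CHAR('a) ^ i)" "{..<n}" 1]
    by (simp add: mult.commute flip: power_mult)
  \<comment> \<open>Frobenius permutes the summands cyclically: adding x restores the term i = 0,
    and the extra last term is x^q = x, so x cancels.\<close>
  also have "\<dots> + x = (\<Sum>i<Suc n. x ^ (CHAR('a) ^ i))"
    unfolding sum.lessThan_Suc_shift by (simp add: add.commute)
  also have "\<dots> = ?s + x"
    by (simp add: x)
  finally show ?thesis
    by (simp add: prime_field_iff_frobenius_fixed trace_poly_altdef[OF n] poly_sum poly_monom)
qed

text \<open>A nonzero polynomial of degree below q has a nonzero value somewhere; scaling its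
  argument by prime field elements then reaches all of the prime field.\<close>

lemma range_trace_poly: "range (poly (trace_poly :: 'a::finite_field poly)) = prime_field"
proof
  obtain n where "0 < n" and n: "CARD('a) = CHAR('a) ^ n"
    by (rule CARD_finite_field_eq_CHAR_power)
  have p: "1 < CHAR('a)"
    using CHAR_prime[where 'a='a] by (rule prime_gt_1_nat)
  let ?B = "trace_poly :: 'a poly"
  \<comment> \<open>Only i = 0 gives the exponent 1, because p > 1.\<close>
  have "coeff ?B 1 = (\<Sum>i<n. if i = 0 then 1 else 0)"
    unfolding trace_poly_altdef[OF n] coeff_sum
    by (intro sum.cong) (use p in auto)
  then have "coeff ?B 1 \<noteq> 0"
    using \<open>0 < n\<close> by simp
  then have "?B \<noteq> 0"
    by (metis coeff_0)
  moreover have "degree ?B < CARD('a)"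
    unfolding trace_poly_altdef[OF n] n
    by (rule degree_lessI) (use p in \<open>auto simp: coeff_sum intro!: sum.neutral dest: power_less_imp_less_exp\<close>)
  ultimately obtain x where x: "poly ?B x \<noteq> 0"
    using poly_eqI_degree[of UNIV ?B 0] by auto
  show "prime_field \<subseteq> range (poly ?B)"
  proof
    fix c :: 'a
    assume "c \<in> prime_field"
    then have "c / poly ?B x \<in> prime_field"
      by (intro prime_field_divide trace_poly_in_prime_field)
    then have "poly ?B (c / poly ?B x * x) = c"
      using x by (subst additive_poly_scale[OF additive_trace_poly]) simp_all
    then show "c \<in> range (poly ?B)"
      by (metis rangeI)
  qed
qed (auto intro: trace_poly_in_prime_field)

text \<open>Pigeonhole: q arguments share at most p < q values, and the difference of two colliding
  arguments lies in the kernel.\<close>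

lemma ker_trace_poly_nontrivial:
  assumes "CHAR('a::finite_field) < CARD('a)"
  obtains z :: "'a::finite_field" where "z \<noteq> 0" "poly trace_poly z = 0"
proof -
  have "card (prime_field :: 'a set) \<le> CHAR('a)"
    using card_image_le[of "{..<CHAR('a)}" "of_nat :: nat \<Rightarrow> 'a"] by (simp add: prime_field_altdef)
  then have "\<not> inj (poly (trace_poly :: 'a poly))"
    using assms card_image[of "poly (trace_poly :: 'a poly)" UNIV] by (auto simp: range_trace_poly)
  then obtain x y :: 'a where "x \<noteq> y" "poly trace_poly x = poly trace_poly y"
    by (auto simp: inj_on_def)
  then show ?thesis
    using that[of "x - y"] by (simp add: additive_poly_diff[OF additive_trace_poly])
qed

theorem theorem3p4:
  fixes g A h :: "'a::finite_field poly"
  assumes "CHAR('a) < CARD('a)"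
    and "A \<in> poly_over prime_field" and "additive_poly A"
    and "h \<in> poly_over prime_field"
  defines "B \<equiv> trace_poly"
  defines "f \<equiv> pcompose g B + pcompose h B * A"
  shows "permutes_on f UNIV \<longleftrightarrow>
    permutes_on A (ker_poly B) \<and>
    permutes_on (pcompose B g + h * A) prime_field \<and>
    (\<forall>x\<in>prime_field. poly h x \<noteq> 0)"
proof -
  define \<phi> where "\<phi> = pcompose B g + h * A"
  have addB: "additive_poly B"
    unfolding B_def by (rule additive_trace_poly)
  have rangeB: "range (poly B) = prime_field"
    unfolding B_def by (rule range_trace_poly)
  then have B_in: "poly B x \<in> prime_field" for x
    by auto
  have BA: "poly B (poly A x) = poly A (poly B x)" for x
    unfolding B_def by (rule trace_poly_commute) fact+
  have f: "poly f x = poly g (poly B x) + poly h (poly B x) * poly A x" for x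
    by (simp add: f_def poly_pcompose)
  \<comment> \<open>The factor h (B x) lies in the prime field, so it can be pulled out of
    \<open>B\<close>.\<close>
  have Bf: "poly B (poly f x) = poly \<phi> (poly B x)" for x
    using poly_over_prime_field_closed[OF assms(4) B_in]
    by (simp add: f \<phi>_def poly_pcompose additive_poly_add[OF addB] additive_poly_scale[OF addB] BA)
  have A_ker: "poly A ` ker_poly B \<subseteq> ker_poly B"
    by (auto simp: ker_poly_def BA additive_poly_0[OF assms(3)])
  show ?thesis
    unfolding \<phi>_def[symmetric]
  proof (intro iffI conjI)
    assume "permutes_on f UNIV"
    then have inj: "inj (poly f)" and surj: "range (poly f) = UNIV"
      by (auto simp: permutes_on_def bij_betw_def)
    have "inj_on (poly A) (ker_poly B)"
    proof (rule inj_onI)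
      fix x y
      assume "x \<in> ker_poly B" "y \<in> ker_poly B" "poly A x = poly A y"
      \<comment> \<open>On the kernel, f x = g 0 + h 0 * A x depends on A x alone.\<close>
      then have "poly f x = poly f y"
        by (simp add: f ker_poly_def)
      with inj show "x = y"
        by (rule injD)
    qed
    with A_ker show "permutes_on A (ker_poly B)"
      by (simp add: permutes_on_def bij_betw_def endo_inj_surj)
    \<comment> \<open>Surjectivity of \<open>f\<close> passes to \<open>\<phi>\<close> through
      \<open>B\<close>; on a finite set this already gives a bijection.\<close>
    have "poly \<phi> ` prime_field = range (\<lambda>x. poly B (poly f x))"
      by (simp add: Bf image_image flip: rangeB)
    also have "\<dots> = prime_field"
      using surj rangeB by (metis image_image)
    finally show "permutes_on \<phi> prime_field"
      by (simp add: permutes_on_def bij_betw_def eq_card_imp_inj_on)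
    show "\<forall>x\<in>prime_field. poly h x \<noteq> 0"
    proof
      fix c :: 'a
      assume "c \<in> prime_field"
      then obtain x where x: "poly B x = c"
        using rangeB by (metis imageE)
      obtain z where z: "z \<noteq> 0" "poly B z = 0"
        using ker_trace_poly_nontrivial[OF assms(1)] unfolding B_def by blast
      \<comment> \<open>Both points lie in the fibre over c, where \<open>f\<close> would be
        constant if h c were 0.\<close>
      have "poly f (x + z) \<noteq> poly f x"
        using inj z(1) by (metis add_cancel_right_right injD)
      then show "poly h c \<noteq> 0"
        by (auto simp: f additive_poly_add[OF addB] x z(2))
    qed
  next
    assume *: "permutes_on A (ker_poly B) \<and> permutes_on \<phi> prime_field \<and>
      (\<forall>x\<in>prime_field. poly h x \<noteq> 0)"
    have "inj (poly f)"
    proof (rule injI)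
      fix x y
      assume eq: "poly f x = poly f y"
      then have "poly \<phi> (poly B x) = poly \<phi> (poly B y)"
        by (metis Bf)
      then have B_eq: "poly B x = poly B y"
        using * B_in by (auto simp: permutes_on_def bij_betw_def dest: inj_onD)
      \<comment> \<open>Within one fibre the \<open>g\<close> terms agree and the common factor h (B
        x) is nonzero, so both cancel.\<close>
      with eq * B_in have "poly A x = poly A y"
        by (simp add: f)
      then have "poly A (x - y) = poly A 0"
        by (simp add: additive_poly_diff additive_poly_0 assms(3))
      moreover have "x - y \<in> ker_poly B" "0 \<in> ker_poly B"
        using B_eq by (simp_all add: ker_poly_def additive_poly_diff[OF addB] additive_poly_0[OF addB])
      ultimately have "x - y = 0"
        using * by (auto simp: permutes_on_def bij_betw_def dest: inj_onD)
      then show "x = y"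
        by simp
    qed
    then show "permutes_on f UNIV"
      by (simp add: permutes_on_def bij_betw_def finite_UNIV_inj_surj)
  qed
qed

end
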